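(* Let $q\in[0,1]$. For $\overline{\gamma}>0$ let $\overline{C}^{\text{Hoyt}}(\overline{\gamma})=\mathbb{E}\{\log_2(1+\gamma)\}$, where $\gamma$ follows the squared Hoyt distribution with average $\overline{\gamma}$ and parameter $q$. Define $$\mu_{\text{Hoyt}}(q)=\log_2(e)\,\gamma_e+\log_2\left(\frac{2(1+q^2)}{(1+q)^2}\right),$$ where $\gamma_e$ is the Euler–Mascheroni constant. Then, in the high-SNR regime, $$\lim_{\overline{\gamma}\to\infty}\left[\overline{C}^{\text{Hoyt}}(\overline{\gamma})-\big(\log_2\overline{\gamma}-\mu_{\text{Hoyt}}(q)\big)\right]=0.$$ Moreover, $\mu_{\text{Hoyt}}(1)=\log_2(e)\gamma_e$ (the value for Rayleigh fading), and the largest value of $\mu_{\text{Hoyt}}$ over $q\in[0,1]$ is attained at $q=0$ and equals $\mu_{\text{Hoyt}}(0)=\log_2(e)\gamma_e+1$.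
   Context: The squared Hoyt distribution with average $\overline{\gamma}>0$ and parameter $q\in[0,1]$ is the distribution of $X^2+Y^2$, where $X,Y$ are independent zero-mean Gaussian random variables with variances $\sigma_x^2>0$ and $\sigma_y^2=q^2\sigma_x^2$, and $\overline{\gamma}=\sigma_x^2+\sigma_y^2$ (for $q=0$, $Y=0$ almost surely; for $q=1$ this is the exponential distribution with mean $\overline{\gamma}$, i.e. Rayleigh fading). *)

theory Defs
  imports "HOL-Probability.Probability"
begin

(* The parameter is the variance v \<ge> 0, whereas normal_density takes the standard deviation.
   The degenerate case v = 0 is separate because normal_density 0 0 is the zero function. *)
definition zero_mean_gaussian :: "real \<Rightarrow> real measure" where
  "zero_mean_gaussian v =
     (if v = 0 then return borel 0 else density lborel (normal_density 0 (sqrt v)))"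

(* With vy = q^2 * vx, the condition g = vx + vy on the average g says vx = g / (1 + q^2). *)
definition squared_Hoyt :: "real \<Rightarrow> real \<Rightarrow> real measure" where
  "squared_Hoyt g q =
     (let vx = g / (1 + q\<^sup>2); vy = q\<^sup>2 * vx in
        distr (zero_mean_gaussian vx \<Otimes>\<^sub>M zero_mean_gaussian vy) borel
          (\<lambda>(x, y). x\<^sup>2 + y\<^sup>2))"

definition C_Hoyt :: "real \<Rightarrow> real \<Rightarrow> real" where
  "C_Hoyt q g = (\<integral>\<gamma>. log 2 (1 + \<gamma>) \<partial>squared_Hoyt g q)"

definition mu_Hoyt :: "real \<Rightarrow> real" where
  "mu_Hoyt q = log 2 (exp 1) * euler_mascheroni + log 2 (2 * (1 + q\<^sup>2) / (1 + q)\<^sup>2)"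

lemma sets_zero_mean_gaussian [simp, measurable_cong]:
  "sets (zero_mean_gaussian v) = sets borel"
  by (simp add: zero_mean_gaussian_def)

lemma prob_space_zero_mean_gaussian:
  assumes "v \<ge> 0"
  shows "prob_space (zero_mean_gaussian v)"
proof (cases "v = 0")
  case True
  then show ?thesis
    by (simp add: zero_mean_gaussian_def prob_space_return)
next
  case False
  with assms show ?thesis
    by (simp add: zero_mean_gaussian_def prob_space_normal_density)
qed

lemma prob_space_squared_Hoyt:
  assumes "g > 0"
  shows "prob_space (squared_Hoyt g q)"
proof -
  interpret X: prob_space "zero_mean_gaussian (g / (1 + q\<^sup>2))"
    using assms by (intro prob_space_zero_mean_gaussian) simp
  interpret Y: prob_space "zero_mean_gaussian (q\<^sup>2 * (g / (1 + q\<^sup>2)))"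
    using assms by (intro prob_space_zero_mean_gaussian) simp
  interpret P: pair_prob_space "zero_mean_gaussian (g / (1 + q\<^sup>2))"
    "zero_mean_gaussian (q\<^sup>2 * (g / (1 + q\<^sup>2)))" ..
  show ?thesis
    unfolding squared_Hoyt_def Let_def by (rule P.prob_space_distr) measurable
qed

lemma (in prob_space) distr_sum_of_squares_squared_Hoyt:
  fixes X Y :: "'a \<Rightarrow> real" and vx vy g q :: real
  assumes indep: "indep_var borel X borel Y"
    and X: "distr M borel X = zero_mean_gaussian vx"
    and Y: "distr M borel Y = zero_mean_gaussian vy"
    and "vx > 0" "vy = q\<^sup>2 * vx" "g = vx + vy"
  shows "distr M borel (\<lambda>\<omega>. (X \<omega>)\<^sup>2 + (Y \<omega>)\<^sup>2) = squared_Hoyt g q"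
proof -
  have [measurable]: "X \<in> borel_measurable M" "Y \<in> borel_measurable M"
    using indep by (auto dest: indep_var_rv1 indep_var_rv2)
  have "1 + q\<^sup>2 \<noteq> 0"
    by (smt (verit) zero_le_power2)
  moreover have "g = vx * (1 + q\<^sup>2)"
    using assms by (simp add: algebra_simps)
  ultimately have vx: "g / (1 + q\<^sup>2) = vx"
    by simp
  have "zero_mean_gaussian vx \<Otimes>\<^sub>M zero_mean_gaussian vy
      = distr M (borel \<Otimes>\<^sub>M borel) (\<lambda>\<omega>. (X \<omega>, Y \<omega>))"
    using indep by (simp add: indep_var_distribution_eq X Y)
  then show ?thesis
    by (simp add: squared_Hoyt_def Let_def vx flip: \<open>vy = q\<^sup>2 * vx\<close>)
       (subst distr_distr; simp add: comp_def)
qed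

end

(* Writing ln (1 + w / c) as the integral of exp (- c t) (1 - exp (- w t)) / t over t > 0 turns
   E[ln (1 + gamma)] into an integral of the Laplace transform
   phi t = ((1 + a t) (1 + b t))^(-1/2) of gamma / g, where a = 2 / (1 + q^2) and b = q^2 a.
   That integrand is nonnegative, so Tonelli applies. The choice phi t = exp (- t) would give
   exactly ln (1 + g), so the error is governed by the integral of (exp (- t) - phi t) / t, by
   dominated convergence. That integral is split at 1 / (1 + t). One part has an elementary
   antiderivative; the other equals minus the Euler-Mascheroni constant, because replacing
   exp (- t) by (1 + t / n)^(- n) makes it 1 / n + ln n minus the n-th harmonic number. *)
theory Submission
  imports Defs "HOL-Real_Asymp.Real_Asymp"
begin

section \<open>Integrals over the positive half-line and the Frullani formula\<close>

lemma set_integral_FTC_Ioi_nonneg: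
  fixes f F :: "real \<Rightarrow> real"
  assumes deriv: "\<And>x. x > 0 \<Longrightarrow> (F has_real_derivative f x) (at x)"
    and cont: "\<And>x. x > 0 \<Longrightarrow> isCont f x"
    and nonneg: "\<And>x. x > 0 \<Longrightarrow> 0 \<le> f x"
    and A: "(F \<longlongrightarrow> A) (at_right 0)" and B: "(F \<longlongrightarrow> B) at_top"
  shows "set_integrable lborel {0<..} f" and "(LINT x:{0<..}|lborel. f x) = B - A"
proof -
  have *: "((F \<circ> real_of_ereal) \<longlongrightarrow> A) (at_right (ereal 0))"
    "((F \<circ> real_of_ereal) \<longlongrightarrow> B) (at_left \<infinity>)"
    using A B by (simp_all add: ereal_tendsto_simps)
  note ftc = interval_integral_FTC_nonneg[of "ereal 0" \<infinity> F f A B, OF _ _ _ _ *]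
  show "set_integrable lborel {0<..} f"
    using ftc(1) assms(1-3) by simp
  show "(LINT x:{0<..}|lborel. f x) = B - A"
    using ftc(2) assms(1-3) by (simp add: interval_lebesgue_integral_def)
qed

lemma nn_integral_Ioi_eq:
  fixes f :: "real \<Rightarrow> real"
  assumes "set_integrable lborel {0<..} f" "\<And>x. x > 0 \<Longrightarrow> 0 \<le> f x"
  shows "(\<integral>\<^sup>+t. ennreal (f t) * indicator {0<..} t \<partial>lborel) = ennreal (LINT x:{0<..}|lborel. f x)"
proof -
  have "(\<integral>\<^sup>+t. ennreal (f t) * indicator {0<..} t \<partial>lborel)
      = (\<integral>\<^sup>+t. ennreal (indicator {0<..} t * f t) \<partial>lborel)"
    by (intro nn_integral_cong) (simp split: split_indicator)
  also have "\<dots> = ennreal (LINT x:{0<..}|lborel. f x)"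
    using assms unfolding set_lebesgue_integral_def set_integrable_def real_scaleR_def
    by (intro nn_integral_eq_integral AE_I2) (auto split: split_indicator)
  finally show ?thesis .
qed

lemma nn_integral_exp_Ioi:
  fixes c :: real
  assumes "c > 0"
  shows "(\<integral>\<^sup>+t. ennreal (exp (- c * t)) * indicator {0<..} t \<partial>lborel) = ennreal (1 / c)"
proof -
  let ?F = "\<lambda>t. - exp (- c * t) / c"
  have D: "(?F has_real_derivative exp (- c * x)) (at x)" for x
    using assms by (auto intro!: derivative_eq_intros)
  have A: "(?F \<longlongrightarrow> - exp (- c * 0) / c) (at_right 0)"
    using assms by (intro tendsto_intros) auto
  have B: "(?F \<longlongrightarrow> 0) at_top"
    using assms by real_asymp
  note ftc = set_integral_FTC_Ioi_nonneg[OF D _ _ A B]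
  show ?thesis
    using assms ftc by (subst nn_integral_Ioi_eq) (auto intro!: continuous_intros)
qed

text \<open>The quotient \<open>(1 - exp (- w * t)) / t\<close> is the integral of
  \<open>exp (- s * t)\<close> over s in [0, w]. Tonelli exchanges s and t, the inner integral
  becomes \<open>1 / (c + s)\<close>, and a logarithm remains. This is how expectations of
  logarithms are reduced to Laplace transforms.\<close>

lemma nn_integral_frullani:
  fixes c w :: real
  assumes c: "c > 0" and w: "w \<ge> 0"
  shows "(\<integral>\<^sup>+t. ennreal (exp (- c * t) * (1 - exp (- w * t)) / t) * indicator {0<..} t \<partial>lborel)
    = ennreal (ln (1 + w / c))"
proof -
  have "ennreal (exp (- c * t) * (1 - exp (- w * t)) / t)
      = (\<integral>\<^sup>+s. ennreal (exp (- (c + s) * t)) * indicator {0..w} s \<partial>lborel)" if "t > 0" for t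
    using that w
    by (subst nn_integral_FTC_Icc[where F="\<lambda>s. - exp (- (c + s) * t) / t"])
       (auto intro!: derivative_eq_intros simp: diff_divide_distrib algebra_simps mult_exp_exp)
  then have "(\<integral>\<^sup>+t. ennreal (exp (- c * t) * (1 - exp (- w * t)) / t) * indicator {0<..} t \<partial>lborel)
    = (\<integral>\<^sup>+t. (\<integral>\<^sup>+s. ennreal (exp (- (c + s) * t)) * indicator {0..w} s * indicator {0<..} t \<partial>lborel) \<partial>lborel)"
    by (intro nn_integral_cong) (simp split: split_indicator)
  also have "\<dots> = (\<integral>\<^sup>+s. (\<integral>\<^sup>+t. ennreal (exp (- (c + s) * t)) * indicator {0..w} s * indicator {0<..} t \<partial>lborel) \<partial>lborel)"
    by (rule lborel_pair.Fubini') measurable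
  also have "\<dots> = (\<integral>\<^sup>+s. ennreal (1 / (c + s)) * indicator {0..w} s \<partial>lborel)"
    using c nn_integral_exp_Ioi[of "c + _"]
    by (intro nn_integral_cong) (auto split: split_indicator)
  also have "\<dots> = ennreal (ln (c + w) - ln (c + 0))"
    using c w by (intro nn_integral_FTC_Icc) (auto intro!: derivative_eq_intros simp: field_simps)
  also have "ln (c + w) - ln (c + 0) = ln (1 + w / c)"
    using c w by (simp add: add_divide_distrib flip: ln_divide_pos)
  finally show ?thesis .
qed

section \<open>Laplace transform of a squared Gaussian\<close>

lemma nn_integral_exp_square_gaussian:
  fixes v s :: real
  assumes v: "v \<ge> 0" and s: "s \<ge> 0"
  shows "(\<integral>\<^sup>+x. ennreal (exp (- s * x\<^sup>2)) \<partial>zero_mean_gaussian v) = ennreal (1 / sqrt (1 + 2 * s * v))"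
proof (cases "v = 0")
  case True
  then show ?thesis
    by (simp add: zero_mean_gaussian_def nn_integral_return)
next
  case False
  with v have v: "v > 0" by simp
  define d where "d = 1 + 2 * s * v"
  have d: "d > 0"
    using v s by (simp add: d_def add_pos_nonneg)
  \<comment> \<open>The factor \<open>exp (- s * x^2)\<close> raises the precision from 1 / v to 1 /
    v + 2 s = d / v. The product is therefore again a centred Gaussian density, now of variance v /
    d, up to the normalising factor 1 / sqrt d, which is the value sought.\<close>
  have eq: "normal_density 0 (sqrt v) x * exp (- s * x\<^sup>2)
      = 1 / sqrt d * normal_density 0 (sqrt (v / d)) x" for x
  proof -
    have "- (x\<^sup>2 / (2 * v)) - s * x\<^sup>2 = - (x\<^sup>2 * d / (2 * v))"
      using v by (simp add: d_def field_simps)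
    then show ?thesis
      using v d by (simp add: normal_density_def real_sqrt_divide real_sqrt_mult mult_exp_exp field_simps
          flip: exp_diff)
  qed
  have "(\<integral>\<^sup>+x. ennreal (exp (- s * x\<^sup>2)) \<partial>zero_mean_gaussian v)
      = (\<integral>\<^sup>+x. ennreal (normal_density 0 (sqrt v) x * exp (- s * x\<^sup>2)) \<partial>lborel)"
    using v by (simp add: zero_mean_gaussian_def nn_integral_density ennreal_mult)
  also have "\<dots> = ennreal (\<integral>x. 1 / sqrt d * normal_density 0 (sqrt (v / d)) x \<partial>lborel)"
    unfolding eq using v d by (intro nn_integral_eq_integral) auto
  also have "\<dots> = ennreal (1 / sqrt d)"
    using v d by simp
  finally show ?thesis
    by (simp add: d_def)
qed

section \<open>Closed forms for the integrals behind the limit constant\<close>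

text \<open>With P and Q the two square roots, the derivative of 2 ln (P + Q) is 1 / u - 1 / (P Q
  u), while 1 / (1 + u) = 1 / u - 1 / (u (1 + u)). In the difference the terms 1 / u cancel, which
  leaves \<open>k\<close> with the antiderivative \<open>?F\<close>.\<close>

lemma
  fixes a b :: real
  assumes ab: "a \<ge> 0" "b \<ge> 0" "a + b = 2"
  defines "k \<equiv> \<lambda>u. (1 / (sqrt (1 + a * u) * sqrt (1 + b * u)) - 1 / (1 + u)) / u"
  shows set_integrable_inverse_sqrt_diff: "set_integrable lborel {0<..} k"
    and LINT_inverse_sqrt_diff: "(LINT u:{0<..}|lborel. k u) = 2 * ln 2 - 2 * ln (sqrt a + sqrt b)"
    and inverse_sqrt_diff_nonneg: "\<And>u. u > 0 \<Longrightarrow> k u \<ge> 0"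
proof -
  let ?F = "\<lambda>u. ln (1 + u) - 2 * ln (sqrt (1 + a * u) + sqrt (1 + b * u))"
  have pos: "1 + a * u > 0" "1 + b * u > 0" if "u > 0" for u
    using ab that by (simp_all add: add_pos_nonneg)
  have D: "(?F has_real_derivative k u) (at u)" if u: "u > 0" for u
  proof -
    define P Q where "P = sqrt (1 + a * u)" and "Q = sqrt (1 + b * u)"
    have PQ: "P > 0" "Q > 0" and sq: "P\<^sup>2 = 1 + a * u" "Q\<^sup>2 = 1 + b * u"
      using pos[OF u] by (auto simp: P_def Q_def)
    have "(?F has_real_derivative 1 / (1 + u) - 2 * ((a / (2 * P) + b / (2 * Q)) / (P + Q))) (at u)"
      using u pos[OF u] add_pos_pos[OF PQ] unfolding P_def Q_def
      by (auto intro!: derivative_eq_intros simp: field_simps)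
    moreover have "1 / (1 + u) - 2 * ((a / (2 * P) + b / (2 * Q)) / (P + Q)) = k u"
    proof -
      \<comment> \<open>Eliminating a and b through a u = P^2 - 1 and b u = Q^2 - 1 exposes the
        factor P + Q, which cancels the denominator of the logarithmic derivative.\<close>
      have "u * (a * Q + b * P) = (P\<^sup>2 - 1) * Q + (Q\<^sup>2 - 1) * P"
        by (simp add: sq algebra_simps)
      also have "\<dots> = (P + Q) * (P * Q - 1)"
        by (simp add: algebra_simps power2_eq_square)
      finally have "a * Q + b * P = (P + Q) * (P * Q - 1) / u"
        using u by (simp add: eq_divide_eq mult.commute)
      moreover have "a / (2 * P) + b / (2 * Q) = (a * Q + b * P) / (2 * P * Q)"
        using PQ by (simp add: field_simps)
      ultimately have X: "2 * ((a / (2 * P) + b / (2 * Q)) / (P + Q)) = (P * Q - 1) / (P * Q * u)"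
        using PQ add_pos_pos[OF PQ] u by (simp add: divide_simps) (simp add: algebra_simps)
      then show ?thesis
        using PQ u unfolding X k_def P_def[symmetric] Q_def[symmetric]
        by (simp add: divide_simps) (simp add: algebra_simps)
    qed
    ultimately show ?thesis by simp
  qed
  show nonneg: "k u \<ge> 0" if u: "u > 0" for u
  proof -
    \<comment> \<open>By AM-GM; the normalisation a + b = 2 makes the arithmetic mean exactly 1 +
      u.\<close>
    have "sqrt (1 + a * u) * sqrt (1 + b * u) \<le> ((1 + a * u) + (1 + b * u)) / 2"
      using pos[OF u] arith_geo_mean_sqrt[of "1 + a * u" "1 + b * u"] by (simp add: real_sqrt_mult)
    also have "\<dots> = 1 + (a + b) * u / 2"
      by (simp add: algebra_simps)
    also have "\<dots> = 1 + u"
      using ab by simp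
    finally show ?thesis
      using pos[OF u] u unfolding k_def
      by (intro divide_nonneg_pos) (auto intro!: divide_left_mono mult_pos_pos)
  qed
  have cont: "isCont k u" if u: "u > 0" for u
    using pos[OF u] u unfolding k_def by (auto intro!: continuous_intros)
  have A: "(?F \<longlongrightarrow> ln (1 + 0) - 2 * ln (sqrt (1 + a * 0) + sqrt (1 + b * 0))) (at_right 0)"
    by (intro tendsto_intros) auto
  \<comment> \<open>Both logarithms may diverge separately. Dividing P + Q by sqrt (1 + u) absorbs
    ln (1 + u), and the ratios under the roots tend to a and b, of which at least one is
    positive.\<close>
  have B: "(?F \<longlongrightarrow> - 2 * ln (sqrt a + sqrt b)) at_top"
  proof (rule Lim_transform_eventually)
    have "sqrt a + sqrt b > 0"
      using ab by (smt (verit) real_sqrt_ge_zero real_sqrt_gt_zero)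
    moreover have lim: "((\<lambda>u. (1 + c * u) / (1 + u)) \<longlongrightarrow> c) at_top" for c :: real
      by real_asymp
    ultimately show "((\<lambda>u. - 2 * ln (sqrt ((1 + a * u) / (1 + u)) + sqrt ((1 + b * u) / (1 + u))))
        \<longlongrightarrow> - 2 * ln (sqrt a + sqrt b)) at_top"
      by (intro tendsto_intros lim) auto
    show "\<forall>\<^sub>F u in at_top. - 2 * ln (sqrt ((1 + a * u) / (1 + u)) + sqrt ((1 + b * u) / (1 + u))) = ?F u"
      using eventually_gt_at_top[of 0]
    proof eventually_elim
      case (elim u)
      have "sqrt ((1 + a * u) / (1 + u)) + sqrt ((1 + b * u) / (1 + u))
          = (sqrt (1 + a * u) + sqrt (1 + b * u)) / sqrt (1 + u)"
        unfolding real_sqrt_divide by (simp only: add_divide_distrib)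
      then show ?case
        using pos[OF elim] elim add_pos_pos[of "sqrt (1 + a * u)" "sqrt (1 + b * u)"]
        by (simp add: ln_div ln_sqrt)
    qed
  qed
  note ftc = set_integral_FTC_Ioi_nonneg[OF D cont nonneg A B]
  show "set_integrable lborel {0<..} k" using ftc(1) by simp
  show "(LINT u:{0<..}|lborel. k u) = 2 * ln 2 - 2 * ln (sqrt a + sqrt b)" using ftc(2) by simp
qed

text \<open>With x = 1 + u / n, the quotient (1 / x - 1 / x^n) / (x - 1) is a finite geometric sum,
  so \<open>k\<close> has an elementary antiderivative. Its sum term at u = 0 yields the harmonic
  number without its last summand; the logarithms yield - ln n at infinity.\<close>

lemma
  fixes n :: nat
  assumes n: "n > 0"
  defines "k \<equiv> \<lambda>u::real. (1 / (1 + u) - 1 / (1 + u / n) ^ n) / u"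
  shows set_integrable_inverse_power_diff: "set_integrable lborel {0<..} k"
    and LINT_inverse_power_diff: "(LINT u:{0<..}|lborel. k u) = harm n - 1 / n - ln n"
    and inverse_power_diff_nonneg: "\<And>u. u > 0 \<Longrightarrow> k u \<ge> 0"
proof -
  let ?F = "\<lambda>u::real. ln (1 + u / n) - ln (1 + u) - (\<Sum>j=1..<n. 1 / (j * (1 + u / n) ^ j))"
  have D: "(?F has_real_derivative k u) (at u)" if u: "u > 0" for u
  proof -
    define x where "x = 1 + u / n"
    have x: "x > 1" and u_eq: "u = n * (x - 1)"
      using u n by (auto simp: x_def)
    have S: "(\<Sum>j=1..<m. 1 / x ^ Suc j) = (1 / x - 1 / x ^ m) / (x - 1)" if "m > 0" for m
      using that
    proof (induction m rule: nat_induct_non_zero)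
      case (Suc m)
      then show ?case
        using x by (simp add: divide_simps) (simp add: algebra_simps)
    qed simp
    have "((\<lambda>u::real. 1 / (j * (1 + u / n) ^ j)) has_real_derivative - (1 / n) * (1 / x ^ Suc j)) (at u)"
      if j: "j \<in> {1..<n}" for j
    proof -
      obtain i where i: "j = Suc i" using j by (cases j) auto
      have "((\<lambda>u. (1 + u / n) ^ j) has_real_derivative j * x ^ i * (1 / n)) (at u)"
        using n unfolding x_def i by (auto intro!: derivative_eq_intros simp del: power_Suc)
      moreover have "(1 + u / n) ^ j \<noteq> 0"
        using x by (simp add: x_def)
      ultimately have "((\<lambda>u. (1 / j) * inverse ((1 + u / n) ^ j)) has_real_derivative
          (1 / j) * - (j * x ^ i * (1 / n) * inverse (((1 + u / n) ^ j) ^ Suc (Suc 0)))) (at u)"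
        by (intro DERIV_cmult DERIV_inverse_fun)
      also have "(1 / j) * - (j * x ^ i * (1 / n) * inverse (((1 + u / n) ^ j) ^ Suc (Suc 0)))
          = - (1 / n) * (1 / x ^ Suc j)"
      proof -
        have "x ^ j = x * x ^ i" "real j \<noteq> 0" "x ^ i \<noteq> 0" "x \<noteq> 0" "real n \<noteq> 0"
          using x n by (simp_all add: i)
        then show ?thesis
          unfolding x_def[symmetric] by (simp add: field_simps)
      qed
      finally show ?thesis
        by (simp add: field_simps)
    qed
    then have "((\<lambda>u. \<Sum>j=1..<n. 1 / (j * (1 + u / n) ^ j)) has_real_derivative
        (\<Sum>j=1..<n. - (1 / n) * (1 / x ^ Suc j))) (at u)"
      by (rule DERIV_sum)
    moreover have "((\<lambda>u. ln (1 + u / n) - ln (1 + u)) has_real_derivative (1 / n) / x - 1 / (1 + u)) (at u)"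
      using x u unfolding x_def by (auto intro!: derivative_eq_intros)
    ultimately have "(?F has_real_derivative (1 / n) / x - 1 / (1 + u)
        - (\<Sum>j=1..<n. - (1 / n) * (1 / x ^ Suc j))) (at u)"
      by (rule DERIV_diff[rotated])
    also have "(1 / n) / x - 1 / (1 + u) - (\<Sum>j=1..<n. - (1 / n) * (1 / x ^ Suc j))
        = (1 / n) / x - 1 / (1 + u) + (1 / n) * ((1 / x - 1 / x ^ n) / (x - 1))"
      unfolding S[OF n, symmetric] sum_distrib_left by (simp add: sum_negf)
    also have "(1 / n) * ((1 / x - 1 / x ^ n) / (x - 1)) = (1 / x - 1 / x ^ n) / u"
      using u_eq by simp
    also have "(1 / n) / x - 1 / (1 + u) + (1 / x - 1 / x ^ n) / u = k u"
    proof -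
      \<comment> \<open>Both identities are partial fractions based on u = n (x - 1). After
        substitution the terms 1 / (x u) cancel, and 1 / u - 1 / (1 + u) recombines into the first
        part of \<open>k u\<close>.\<close>
      have "(1 / n) / x = (1 - 1 / x) / u"
        using x n u by (simp add: divide_simps) (simp add: u_eq)
      moreover have "(1 / (1 + u)) / u = 1 / u - 1 / (1 + u)"
        using u by (simp add: divide_simps)
      ultimately show ?thesis
        unfolding k_def x_def[symmetric] diff_divide_distrib by linarith
    qed
    finally show ?thesis .
  qed
  show nonneg: "k u \<ge> 0" if u: "u > 0" for u
  proof -
    have "1 + u \<le> (1 + u / n) ^ n"
      using Bernoulli_inequality[of "u / n" n] u n by (simp add: order_trans[of _ 0])
    then show ?thesis
      using u unfolding k_def
      by (intro divide_nonneg_pos) (auto intro!: divide_left_mono mult_pos_pos add_pos_nonneg zero_less_power)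
  qed
  have cont: "isCont k u" if u: "u > 0" for u
  proof -
    have "1 + u / n > 0" using u by (simp add: add_pos_nonneg)
    then show ?thesis using u n unfolding k_def by (auto intro!: continuous_intros)
  qed
  have A: "(?F \<longlongrightarrow> ln (1 + 0 / n) - ln (1 + 0) - (\<Sum>j=1..<n. 1 / (j * (1 + 0 / n) ^ j))) (at_right 0)"
    using n by (intro tendsto_intros) auto
  have "((\<lambda>u. 1 / (j * (1 + u / n) ^ j)) \<longlongrightarrow> 0) at_top" if "j \<in> {1..<n}" for j
  proof -
    have "j > 0" "real n > 0" using that by auto
    then show ?thesis by real_asymp
  qed
  moreover have "((\<lambda>u. ln (1 + u / n) - ln (1 + u)) \<longlongrightarrow> - ln n) at_top"
  proof -
    have "real n > 0" using n by simp
    then show ?thesis by (real_asymp simp: ln_inverse)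
  qed
  ultimately have B: "(?F \<longlongrightarrow> - ln n - (\<Sum>j=1..<n. 0)) at_top"
    by (intro tendsto_diff tendsto_sum)
  note ftc = set_integral_FTC_Ioi_nonneg[OF D cont nonneg A B]
  show "set_integrable lborel {0<..} k" using ftc(1) by simp
  \<comment> \<open>The sum in \<open>?F\<close> stops at n - 1, which is where the correction - 1 /
    n comes from.\<close>
  have "harm n = (\<Sum>j=1..<n. 1 / real j) + 1 / n"
    using n by (cases n) (simp_all add: harm_def inverse_eq_divide atLeastLessThanSuc_atLeastAtMost)
  then show "(LINT u:{0<..}|lborel. k u) = harm n - 1 / n - ln n" using ftc(2) by simp
qed

text \<open>Since (1 + u / n)^n increases to exp u along the chosen n, the integrands of the
  preceding result increase to \<open>k\<close>. Monotone convergence gives both integrability and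
  the limit of harm n - ln n - 1 / n as the value.\<close>

lemma
  defines "k \<equiv> \<lambda>u::real. (1 / (1 + u) - exp (- u)) / u"
  shows set_integrable_euler_mascheroni: "set_integrable lborel {0<..} k"
    and LINT_euler_mascheroni: "(LINT u:{0<..}|lborel. k u) = euler_mascheroni"
proof -
  \<comment> \<open>Along powers of two, monotonicity of \<open>(1 + u / n) ^ n\<close> is just squaring.\<close>
  let ?n = "\<lambda>m::nat. 2 ^ m :: nat"
  let ?k = "\<lambda>m u::real. (1 / (1 + u) - 1 / (1 + u / ?n m) ^ ?n m) / u"
  have n: "?n m > 0" for m by simp
  have lim_n: "filterlim ?n at_top sequentially"
    by (rule filterlim_subseq) (simp add: strict_mono_def)
  have le: "(1 + u / ?n m) ^ ?n m \<le> (1 + u / ?n (Suc m)) ^ ?n (Suc m)" if "u > 0" for m and u :: real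
  proof -
    have "1 + u / ?n m \<le> (1 + u / ?n (Suc m))\<^sup>2"
      by (simp add: power2_eq_square algebra_simps)
    then have "(1 + u / ?n m) ^ ?n m \<le> ((1 + u / ?n (Suc m))\<^sup>2) ^ ?n m"
      using that by (intro power_mono) auto
    then show ?thesis
      by (simp add: power_mult[symmetric])
  qed
  have mono: "mono (\<lambda>m. ?k m u)" if u: "u > 0" for u
    unfolding mono_iff_le_Suc
    using u le[OF u] by (intro allI divide_right_mono diff_left_mono divide_left_mono mult_pos_pos
        zero_less_power add_pos_nonneg) auto
  have lim: "(\<lambda>m. ?k m u) \<longlonglongrightarrow> k u" if u: "u > 0" for u
  proof -
    have "(\<lambda>m. (1 + u / ?n m) ^ ?n m) \<longlonglongrightarrow> exp u"
      using filterlim_compose[OF tendsto_exp_limit_sequentially lim_n] by simp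
    then have "(\<lambda>m. ?k m u) \<longlonglongrightarrow> (1 / (1 + u) - 1 / exp u) / u"
      using u by (intro tendsto_intros) auto
    then show ?thesis
      by (simp add: k_def exp_minus inverse_eq_divide)
  qed
  have "(\<lambda>n. harm n - ln (real n) - 1 / n) \<longlonglongrightarrow> euler_mascheroni - 0"
    by (intro tendsto_diff euler_mascheroni_LIMSEQ lim_1_over_n)
  from filterlim_compose[OF this lim_n]
  have I: "(\<lambda>m. LINT u:{0<..}|lborel. ?k m u) \<longlonglongrightarrow> euler_mascheroni"
    unfolding LINT_inverse_power_diff[OF n] by (simp add: algebra_simps)
  have *: "integrable lborel (\<lambda>u. indicator {0<..} u * ?k m u)" for m
    using set_integrable_inverse_power_diff[OF n] by (simp add: set_integrable_def)
  have 1: "AE u in lborel. mono (\<lambda>m. indicator {0<..} u * ?k m u)"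
    using mono by (auto simp: indicator_def mono_def)
  have 2: "AE u in lborel. 0 \<le> indicator {0<..} u * ?k m u" for m
    using inverse_power_diff_nonneg[OF n] by (auto simp: indicator_def)
  have 3: "AE u in lborel. (\<lambda>m. indicator {0<..} u * ?k m u) \<longlonglongrightarrow> indicator {0<..} u * k u"
    using lim by (auto simp: indicator_def)
  have 4: "(\<lambda>u. indicator {0<..} u * k u) \<in> borel_measurable lborel"
    unfolding k_def by measurable
  have 5: "(\<lambda>m. LINT u|lborel. indicator {0<..} u * ?k m u) \<longlonglongrightarrow> euler_mascheroni"
    using I by (simp add: set_lebesgue_integral_def)
  note mc = integral_monotone_convergence_nonneg[OF * 1 2 3 5 4]
  show "set_integrable lborel {0<..} k" "(LINT u:{0<..}|lborel. k u) = euler_mascheroni"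
    using mc by (simp_all add: set_integrable_def set_lebesgue_integral_def)
qed

text \<open>Inserting 1 / (1 + t) between the two terms of \<open>h\<close> makes it minus the sum
  of the two integrands just evaluated, each integrable on its own.\<close>

lemma
  fixes a b :: real
  assumes ab: "a \<ge> 0" "b \<ge> 0" "a + b = 2"
  defines "h \<equiv> \<lambda>t. (exp (- t) - 1 / (sqrt (1 + a * t) * sqrt (1 + b * t))) / t"
  shows set_integrable_exp_inverse_sqrt_diff: "set_integrable lborel {0<..} h"
    and LINT_exp_inverse_sqrt_diff:
      "(LINT t:{0<..}|lborel. h t) = 2 * ln (sqrt a + sqrt b) - 2 * ln 2 - euler_mascheroni"
proof -
  let ?k = "\<lambda>u. (1 / (sqrt (1 + a * u) * sqrt (1 + b * u)) - 1 / (1 + u)) / u"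
  let ?l = "\<lambda>u::real. (1 / (1 + u) - exp (- u)) / u"
  have h: "h = (\<lambda>u. - (?k u + ?l u))"
    by (auto simp: h_def diff_divide_distrib)
  note int = set_integrable_inverse_sqrt_diff[OF ab] set_integrable_euler_mascheroni
  note add = set_integral_add[OF int]
  show "set_integrable lborel {0<..} h"
    unfolding h using add(1) unfolding set_integrable_def scaleR_minus_right by (rule integrable_minus)
  show "(LINT t:{0<..}|lborel. h t) = 2 * ln (sqrt a + sqrt b) - 2 * ln 2 - euler_mascheroni"
    unfolding h set_integral_uminus[OF add(1)]
    by (simp only: add(2) LINT_inverse_sqrt_diff[OF ab] LINT_euler_mascheroni)
qed

section \<open>Exact integral formula for the capacity\<close>

lemma nn_integral_exp_sum_squares_gaussian:
  fixes s vx vy :: real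
  assumes "s \<ge> 0" "vx \<ge> 0" "vy \<ge> 0"
  shows "(\<integral>\<^sup>+p. ennreal (exp (- s * ((fst p)\<^sup>2 + (snd p)\<^sup>2))) \<partial>(zero_mean_gaussian vx \<Otimes>\<^sub>M zero_mean_gaussian vy))
    = ennreal (1 / (sqrt (1 + 2 * s * vx) * sqrt (1 + 2 * s * vy)))"
proof -
  interpret Y: prob_space "zero_mean_gaussian vy"
    by (rule prob_space_zero_mean_gaussian) fact
  have "(\<integral>\<^sup>+p. ennreal (exp (- s * ((fst p)\<^sup>2 + (snd p)\<^sup>2))) \<partial>(zero_mean_gaussian vx \<Otimes>\<^sub>M zero_mean_gaussian vy))
    = (\<integral>\<^sup>+x. \<integral>\<^sup>+y. ennreal (exp (- s * x\<^sup>2)) * ennreal (exp (- s * y\<^sup>2)) \<partial>zero_mean_gaussian vy \<partial>zero_mean_gaussian vx)"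
    by (subst Y.nn_integral_fst[symmetric])
       (auto simp: algebra_simps mult_exp_exp simp flip: ennreal_mult)
  also have "\<dots> = ennreal (1 / sqrt (1 + 2 * s * vx)) * ennreal (1 / sqrt (1 + 2 * s * vy))"
    using assms by (simp add: nn_integral_cmult nn_integral_multc nn_integral_exp_square_gaussian[simplified])
  also have "\<dots> = ennreal (1 / (sqrt (1 + 2 * s * vx) * sqrt (1 + 2 * s * vy)))"
    using assms by (simp flip: ennreal_mult)
  finally show ?thesis .
qed

text \<open>Subtraction truncates in \<open>ennreal\<close>, so the computation passes through the
  real-valued integral, where linearity and total mass 1 apply.\<close>

lemma (in prob_space) nn_integral_mult_one_minus:
  fixes f :: "'a \<Rightarrow> real"
  assumes [measurable]: "f \<in> borel_measurable M"
    and f: "\<And>x. 0 \<le> f x" "\<And>x. f x \<le> 1"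
    and L: "(\<integral>\<^sup>+x. ennreal (f x) \<partial>M) = ennreal L" "0 \<le> L" and c: "0 \<le> c"
  shows "(\<integral>\<^sup>+x. ennreal (c * (1 - f x)) \<partial>M) = ennreal (c * (1 - L))"
proof -
  have "integrable M f \<and> integral\<^sup>L M f = L"
    using L f by (subst nn_integral_eq_integrable[symmetric]) auto
  then have "(\<integral>x. c * (1 - f x) \<partial>M) = c * (1 - L)" "integrable M (\<lambda>x. c * (1 - f x))"
    by (auto simp: prob_space)
  then show ?thesis
    using f c by (subst nn_integral_eq_integral) auto
qed

text \<open>Laplace transforms are taken of the normalised variable gamma / g. Then \<open>h\<close>
  does not depend on g, which enters the integral only through the damping factor
  \<open>exp (- (1 / g) * t)\<close>. The formula is exact for every g > 0.\<close>

lemma C_Hoyt_eq: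
  fixes q g :: real
  assumes g: "g > 0"
  defines "a \<equiv> 2 / (1 + q\<^sup>2)" and "b \<equiv> 2 * q\<^sup>2 / (1 + q\<^sup>2)"
  defines "h \<equiv> \<lambda>t. (exp (- t) - 1 / (sqrt (1 + a * t) * sqrt (1 + b * t))) / t"
  shows "C_Hoyt q g = (ln (1 + g) + (LINT t:{0<..}|lborel. exp (- (1 / g) * t) * h t)) / ln 2"
proof -
  have q: "1 + q\<^sup>2 > 0"
    by (simp add: add_pos_nonneg)
  have ab: "a \<ge> 0" "b \<ge> 0" "a + b = 2"
    using q by (simp_all add: a_def b_def add_divide_distrib[symmetric]) (simp add: divide_eq_eq)
  define vx vy where "vx = g / (1 + q\<^sup>2)" and "vy = q\<^sup>2 * vx"
  have v: "vx \<ge> 0" "vy \<ge> 0"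
    using g q by (simp_all add: vx_def vy_def)
  \<comment> \<open>Thus a and b are twice the two variances divided by g, and their sum is
    2.\<close>
  have av: "2 * (t / g) * vx = a * t" and bv: "2 * (t / g) * vy = b * t" for t
    using g by (simp_all add: a_def b_def vx_def vy_def)
  let ?P = "zero_mean_gaussian vx \<Otimes>\<^sub>M zero_mean_gaussian vy"
  interpret X: prob_space "zero_mean_gaussian vx"
    by (rule prob_space_zero_mean_gaussian) fact
  interpret Y: prob_space "zero_mean_gaussian vy"
    by (rule prob_space_zero_mean_gaussian) fact
  interpret P: pair_prob_space "zero_mean_gaussian vx" "zero_mean_gaussian vy" ..
  interpret PL: pair_sigma_finite lborel ?P ..
  define r where "r p = (fst p)\<^sup>2 + (snd p)\<^sup>2" for p :: "real \<times> real"
  have [measurable]: "r \<in> borel_measurable ?P"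
    unfolding r_def by measurable
  have r: "r p \<ge> 0" for p
    by (simp add: r_def)
  define \<phi> where "\<phi> t = 1 / (sqrt (1 + a * t) * sqrt (1 + b * t))" for t
  let ?f = "\<lambda>t. exp (- (1 / g) * t) * (1 - \<phi> t) / t"
  let ?e = "\<lambda>t. exp (- (1 / g) * t) * (1 - exp (- 1 * t)) / t"
  let ?J = "LINT t:{0<..}|lborel. exp (- (1 / g) * t) * h t"
  have f_nonneg: "?f t \<ge> 0" if "t > 0" for t
  proof -
    have "1 \<le> sqrt (1 + a * t) * sqrt (1 + b * t)"
      using ab that mult_mono[of 1 "sqrt (1 + a * t)" 1 "sqrt (1 + b * t)"] by simp
    then show ?thesis
      using that by (simp add: \<phi>_def)
  qed
  have e_nonneg: "?e t \<ge> 0" if "t > 0" for t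
    using that by simp

  \<comment> \<open>Frullani with c = 1 / g and w = 1: this is the contribution of a constant gamma
    = g, whose normalised Laplace transform is exp (- t).\<close>
  have int_e: "set_integrable lborel {0<..} ?e" and I_e: "(LINT t:{0<..}|lborel. ?e t) = ln (1 + g)"
  proof -
    have "(\<integral>\<^sup>+t. ennreal (indicator {0<..} t * ?e t) \<partial>lborel)
        = (\<integral>\<^sup>+t. ennreal (?e t) * indicator {0<..} t \<partial>lborel)"
      by (intro nn_integral_cong) (simp split: split_indicator)
    also have "\<dots> = ennreal (ln (1 + g))"
      using g nn_integral_frullani[of "1 / g" 1] by simp
    finally have "integrable lborel (\<lambda>t. indicator {0<..} t * ?e t) \<and>
        (LINT t|lborel. indicator {0<..} t * ?e t) = ln (1 + g)"
      using g e_nonneg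
      by (subst nn_integral_eq_integrable[symmetric]) (auto split: split_indicator)
    then show "set_integrable lborel {0<..} ?e" "(LINT t:{0<..}|lborel. ?e t) = ln (1 + g)"
      by (simp_all add: set_integrable_def set_lebesgue_integral_def)
  qed
  have int_h: "set_integrable lborel {0<..} (\<lambda>t. exp (- (1 / g) * t) * h t)"
  proof (rule set_integrable_bound)
    show "set_integrable lborel {0<..} h"
      unfolding h_def by (rule set_integrable_exp_inverse_sqrt_diff[OF ab])
    show "set_borel_measurable lborel {0<..} (\<lambda>t. exp (- (1 / g) * t) * h t)"
      unfolding set_borel_measurable_def h_def by measurable
    show "AE t in lborel. t \<in> {0<..} \<longrightarrow> norm (exp (- (1 / g) * t) * h t) \<le> norm (h t)"
      using g by (auto simp: abs_mult intro!: mult_left_le_one_le)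
  qed
  \<comment> \<open>Splits 1 - \<phi> t as (1 - exp (- t)) + (exp (- t) - \<phi> t): the main term
    plus the error.\<close>
  have f_eq: "?f = (\<lambda>t. ?e t + exp (- (1 / g) * t) * h t)"
    by (auto simp: h_def \<phi>_def fun_eq_iff add_divide_distrib[symmetric] algebra_simps)
  note add = set_integral_add[OF int_e int_h, folded f_eq]

  have meas: "case_prod (\<lambda>t p. ennreal (exp (- (1 / g) * t) * (1 - exp (- (r p / g) * t)) / t) * indicator {0<..} t)
      \<in> borel_measurable (lborel \<Otimes>\<^sub>M ?P)"
    by measurable
  \<comment> \<open>Frullani with c = 1 / g and w = r p / g, so that w / c = r p.\<close>
  have "(\<integral>\<^sup>+p. ennreal (ln (1 + r p)) \<partial>?P)
      = (\<integral>\<^sup>+p. (\<integral>\<^sup>+t. ennreal (exp (- (1 / g) * t) * (1 - exp (- (r p / g) * t)) / t) * indicator {0<..} t \<partial>lborel) \<partial>?P)"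
    using g r nn_integral_frullani[of "1 / g" "r _ / g"] by simp
  also have "\<dots> = (\<integral>\<^sup>+t. (\<integral>\<^sup>+p. ennreal (exp (- (1 / g) * t) * (1 - exp (- (r p / g) * t)) / t) * indicator {0<..} t \<partial>?P) \<partial>lborel)"
    by (rule PL.Fubini'[OF meas])
  also have "\<dots> = (\<integral>\<^sup>+t. ennreal (?f t) * indicator {0<..} t \<partial>lborel)"
  proof (intro nn_integral_cong)
    fix t :: real
    show "(\<integral>\<^sup>+p. ennreal (exp (- (1 / g) * t) * (1 - exp (- (r p / g) * t)) / t) * indicator {0<..} t \<partial>?P)
        = ennreal (?f t) * indicator {0<..} t"
    proof (cases "t > 0")
      case True
      have "(\<integral>\<^sup>+p. ennreal (exp (- (t / g) * r p)) \<partial>?P) = ennreal (\<phi> t)"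
        unfolding r_def \<phi>_def av[symmetric] bv[symmetric]
        using True g v by (intro nn_integral_exp_sum_squares_gaussian) auto
      moreover have "exp (- (t / g) * r p) \<le> 1" for p
        using True g r by (auto intro!: divide_nonneg_pos mult_nonneg_nonneg)
      moreover have "\<phi> t \<ge> 0"
        using ab True by (simp add: \<phi>_def)
      ultimately have "(\<integral>\<^sup>+p. ennreal (exp (- (1 / g) * t) / t * (1 - exp (- (t / g) * r p))) \<partial>?P)
          = ennreal (exp (- (1 / g) * t) / t * (1 - \<phi> t))"
        using True by (intro P.nn_integral_mult_one_minus) auto
      then show ?thesis
        using True by (simp add: mult.commute)
    qed simp
  qed
  also have "\<dots> = ennreal (LINT t:{0<..}|lborel. ?f t)"
    by (intro nn_integral_Ioi_eq add(1) f_nonneg)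
  also have "(LINT t:{0<..}|lborel. ?f t) = ln (1 + g) + ?J"
    using add(2) I_e by simp
  finally have nn: "(\<integral>\<^sup>+p. ennreal (ln (1 + r p)) \<partial>?P) = ennreal (ln (1 + g) + ?J)" .
  \<comment> \<open>\<open>ennreal\<close> sends negative reals to 0, so the sign of the right-hand
    side must be known before \<open>nn\<close> can be read as an equation between reals.\<close>
  have "ln (1 + g) + ?J = (LINT t:{0<..}|lborel. ?f t)"
    using add(2) I_e by simp
  also have "\<dots> \<ge> 0"
    unfolding set_lebesgue_integral_def using f_nonneg
    by (intro integral_nonneg_AE) (auto split: split_indicator)
  finally have "(\<integral>p. ln (1 + r p) \<partial>?P) = ln (1 + g) + ?J"
    using nn r by (subst (asm) nn_integral_eq_integrable) auto
  moreover have "C_Hoyt q g = (\<integral>p. log 2 (1 + r p) \<partial>?P)"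
    unfolding C_Hoyt_def squared_Hoyt_def Let_def vx_def[symmetric] vy_def[symmetric]
    by (subst integral_distr) (auto simp: r_def case_prod_unfold)
  ultimately show ?thesis
    by (simp add: log_def)
qed

section \<open>High-SNR limit of the capacity\<close>

text \<open>The damping factor tends to 1 at each fixed t and, for t > 0 and g > 0, is at most 1, so
  the absolute value of \<open>h\<close> dominates.\<close>

lemma tendsto_LINT_exp_mult:
  fixes h :: "real \<Rightarrow> real"
  assumes h: "set_integrable lborel {0<..} h"
  shows "((\<lambda>g. LINT t:{0<..}|lborel. exp (- (1 / g) * t) * h t) \<longlongrightarrow> (LINT t:{0<..}|lborel. h t)) at_top"
proof -
  have [measurable]: "(\<lambda>t. indicator {0<..} t * h t) \<in> borel_measurable lborel"
    using borel_measurable_integrable[OF h[unfolded set_integrable_def]] by simp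
  have "((\<lambda>g. LINT t|lborel. exp (- (1 / g) * t) * (indicator {0<..} t * h t))
      \<longlongrightarrow> (LINT t|lborel. indicator {0<..} t * h t)) at_top"
  proof (rule integral_dominated_convergence_at_top)
    show "integrable lborel (\<lambda>t. norm (indicator {0<..} t * h t))"
      using h by (simp add: set_integrable_def del: real_norm_def)
    have "((\<lambda>g. exp (- (1 / g) * t) * x) \<longlongrightarrow> x) at_top" for t x :: real
      by real_asymp
    then show "AE t in lborel. ((\<lambda>g. exp (- (1 / g) * t) * (indicator {0<..} t * h t))
        \<longlongrightarrow> indicator {0<..} t * h t) at_top"
      by simp
    show "\<forall>\<^sub>F g in at_top. AE t in lborel.
        norm (exp (- (1 / g) * t) * (indicator {0<..} t * h t)) \<le> norm (indicator {0<..} t * h t)"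
      using eventually_gt_at_top[of 0]
      by eventually_elim
         (auto simp: abs_mult indicator_def intro!: mult_left_le_one_le)
  qed measurable
  then show ?thesis
    by (simp add: set_lebesgue_integral_def mult.left_commute)
qed

lemma tendsto_C_Hoyt:
  assumes q: "q \<ge> 0"
  shows "((\<lambda>g. C_Hoyt q g - (log 2 g - mu_Hoyt q)) \<longlongrightarrow> 0) at_top"
proof -
  define a b where "a = 2 / (1 + q\<^sup>2)" and "b = 2 * q\<^sup>2 / (1 + q\<^sup>2)"
  define h where "h t = (exp (- t) - 1 / (sqrt (1 + a * t) * sqrt (1 + b * t))) / t" for t
  have q2: "1 + q\<^sup>2 > 0"
    by (simp add: add_pos_nonneg)
  have ab: "a \<ge> 0" "b \<ge> 0" "a + b = 2"
    using q2 by (simp_all add: a_def b_def add_divide_distrib[symmetric]) (simp add: divide_eq_eq)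
  let ?J = "\<lambda>g. LINT t:{0<..}|lborel. exp (- (1 / g) * t) * h t"
  let ?I = "2 * ln (sqrt a + sqrt b) - 2 * ln 2 - euler_mascheroni"
  have J: "(?J \<longlongrightarrow> ?I) at_top"
    using tendsto_LINT_exp_mult[OF set_integrable_exp_inverse_sqrt_diff[OF ab]]
      LINT_exp_inverse_sqrt_diff[OF ab] by (simp add: h_def)
  \<comment> \<open>Here q \<ge> 0 gives sqrt (q^2) = q; this is the source of the factor (1 + q)^2
    in \<open>mu_Hoyt\<close>.\<close>
  have "sqrt b = q * sqrt a"
    using q by (simp add: a_def b_def real_sqrt_divide real_sqrt_mult)
  then have "sqrt a + sqrt b = (1 + q) * sqrt a"
    by (simp add: algebra_simps)
  then have 1: "ln (sqrt a + sqrt b) = ln (1 + q) + (ln 2 - ln (1 + q\<^sup>2)) / 2"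
    using q q2 by (simp add: a_def ln_mult ln_div ln_sqrt)
  have 2: "ln (2 * (1 + q\<^sup>2) / (1 + q)\<^sup>2) = ln 2 + ln (1 + q\<^sup>2) - 2 * ln (1 + q)"
    using q q2 by (simp add: ln_mult ln_div ln_realpow del: distrib_left_numeral)
  have 3: "ln 2 * mu_Hoyt q = euler_mascheroni + ln (2 * (1 + q\<^sup>2) / (1 + q)\<^sup>2)"
    unfolding mu_Hoyt_def log_def distrib_left by simp
  \<comment> \<open>The limit of the error integral is exactly the offset, converted to natural
    logarithms.\<close>
  have I: "?I = - (ln 2 * mu_Hoyt q)"
    by (simp only: 1 2 3) (simp add: diff_divide_distrib)
  have "((\<lambda>g::real. ln (1 + g) - ln g) \<longlongrightarrow> 0) at_top"
    by real_asymp
  then have "((\<lambda>g. (ln (1 + g) - ln g + ?J g) / ln 2 + mu_Hoyt q) \<longlongrightarrow> (0 + ?I) / ln 2 + mu_Hoyt q) at_top"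
    by (intro tendsto_intros J) auto
  then have lim: "((\<lambda>g. (ln (1 + g) - ln g + ?J g) / ln 2 + mu_Hoyt q) \<longlongrightarrow> 0) at_top"
    by (simp add: I)
  show ?thesis
  proof (rule Lim_transform_eventually[OF lim])
    show "\<forall>\<^sub>F g in at_top. (ln (1 + g) - ln g + ?J g) / ln 2 + mu_Hoyt q
        = C_Hoyt q g - (log 2 g - mu_Hoyt q)"
      using eventually_gt_at_top[of 0]
      by eventually_elim
         (simp add: C_Hoyt_eq h_def a_def b_def log_def add_divide_distrib diff_divide_distrib)
  qed
qed

section \<open>Special values and maximum of the offset\<close>

lemma mu_Hoyt_0: "mu_Hoyt 0 = log 2 (exp 1) * euler_mascheroni + 1"
  by (simp add: mu_Hoyt_def)

lemma mu_Hoyt_1: "mu_Hoyt 1 = log 2 (exp 1) * euler_mascheroni"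
  by (simp add: mu_Hoyt_def)

lemma mu_Hoyt_le:
  assumes "q \<ge> 0"
  shows "mu_Hoyt q \<le> mu_Hoyt 0"
proof -
  \<comment> \<open>Because (1 + q)^2 exceeds 1 + q^2 by 2 q \<ge> 0; the bound 2 is the value at q
    = 0.\<close>
  have "2 * (1 + q\<^sup>2) / (1 + q)\<^sup>2 \<le> 2"
    using assms by (subst pos_divide_le_eq) (simp, simp add: power2_sum)
  moreover have "2 * (1 + q\<^sup>2) / (1 + q)\<^sup>2 > 0"
    using assms by (auto intro!: divide_pos_pos mult_pos_pos add_pos_nonneg)
  ultimately have "log 2 (2 * (1 + q\<^sup>2) / (1 + q)\<^sup>2) \<le> log 2 2"
    by (subst log_le_cancel_iff) auto
  then show ?thesis
    by (simp add: mu_Hoyt_def)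
qed

theorem mainTheorem5:
  shows "(\<forall>q\<in>{0..1}. ((\<lambda>g. C_Hoyt q g - (log 2 g - mu_Hoyt q)) \<longlongrightarrow> 0) at_top)
    \<and> mu_Hoyt 1 = log 2 (exp 1) * euler_mascheroni
    \<and> (\<forall>q\<in>{0..1}. mu_Hoyt q \<le> mu_Hoyt 0)
    \<and> mu_Hoyt 0 = log 2 (exp 1) * euler_mascheroni + 1"
  using tendsto_C_Hoyt mu_Hoyt_1 mu_Hoyt_le mu_Hoyt_0 by simp

end
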